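(* Let $k, m$ be integers with $0 < k \leq m < \infty$, let $0 < \theta \leq 1$, and let $T_k \sim \text{NegOcc}(m,k,\theta)$. The probability generating function $G(z) = \mathbb{E}(z^{T_k})$, characteristic function $\phi(s) = \mathbb{E}(e^{isT_k})$, moment generating function $M(s) = \mathbb{E}(e^{sT_k})$ and cumulant generating function $K(s) = \ln M(s)$ are given respectively by $$G(z) = \theta^k \prod_{\ell=m-k+1}^{m} \frac{\ell}{m-(m-\ell\theta)z}, \qquad |z| < \frac{m}{m-(m-k+1)\theta},$$ $$\phi(s) = \theta^k \prod_{\ell=m-k+1}^{m} \frac{\ell}{m-(m-\ell\theta)e^{is}}, \qquad |s| < \ln\left(\frac{m}{m-(m-k+1)\theta}\right),$$ $$M(s) = \theta^k \prod_{\ell=m-k+1}^{m} \frac{\ell}{m-(m-\ell\theta)e^{s}}, \qquad s < \ln\left(\frac{m}{m-(m-k+1)\theta}\right),$$ $$K(s) = k\ln(\theta) + \sum_{\ell=m-k+1}^{m} \ln\left(\frac{\ell}{m-(m-\ell\theta)e^{s}}\right), \qquad s < \ln\left(\frac{m}{m-(m-k+1)\theta}\right).$$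
   Context: Falling factorials: $(m)_k = \prod_{i=0}^{k-1}(m-i)$. The noncentral Stirling numbers of the second kind are, for integers $n, k \geq 0$ and real $\phi$, $$S(n,k,\phi) = \frac{1}{k!}\sum_{i=0}^{k} \binom{k}{i} (-1)^{k-i} (i+\phi)^n, \qquad 0^0 = 1.$$ The negative occupancy distribution $\text{NegOcc}(m,k,\theta)$ is the distribution on the integers $t \geq 0$ with probability mass function $$\text{NegOcc}(t|m,k,\theta) = \frac{\theta^{k+t}}{m^{k+t}} \cdot (m)_k \cdot S\left(k+t-1, k-1, m\cdot\frac{1-\theta}{\theta}\right).$$ In the claim $s$ is real in $\phi$, $M$ and $K$, and in the degenerate case $k=1$, $\theta=1$ (where $m-(m-k+1)\theta = 0$) the upper bounds are read as $+\infty$. *)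

theory Defs
  imports "HOL-Probability.Probability"
begin

definition falling_factorial :: "real \<Rightarrow> nat \<Rightarrow> real" where
  "falling_factorial x k = (\<Prod>i<k. x - real i)"

definition nc_stirling2 :: "nat \<Rightarrow> nat \<Rightarrow> real \<Rightarrow> real" where
  "nc_stirling2 n k \<phi> =
     1 / fact k * (\<Sum>i\<le>k. real (k choose i) * (-1) ^ (k - i) * (real i + \<phi>) ^ n)"

(* The truncated subtractions are only meaningful for k > 0. *)
definition neg_occ_mass :: "nat \<Rightarrow> nat \<Rightarrow> real \<Rightarrow> nat \<Rightarrow> real" where
  "neg_occ_mass m k \<theta> t =
     \<theta> ^ (k + t) / real m ^ (k + t) * falling_factorial (real m) k *
     nc_stirling2 (k + t - 1) (k - 1) (real m * ((1 - \<theta>) / \<theta>))"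

(* For 0 < k \<le> m and 0 < \<theta> \<le> 1 the mass function is a genuine one, so embed_pmf
   takes no junk value: see pmf_neg_occ below. *)
definition neg_occ :: "nat \<Rightarrow> nat \<Rightarrow> real \<Rightarrow> nat pmf" where
  "neg_occ m k \<theta> = embed_pmf (neg_occ_mass m k \<theta>)"

definition prob_gen_fun :: "'a measure \<Rightarrow> ('a \<Rightarrow> nat) \<Rightarrow> complex \<Rightarrow> complex" where
  "prob_gen_fun \<Omega> T z = (LINT \<omega>|\<Omega>. z ^ T \<omega>)"

definition moment_gen_fun :: "'a measure \<Rightarrow> ('a \<Rightarrow> real) \<Rightarrow> real \<Rightarrow> real" where
  "moment_gen_fun \<Omega> X s = (LINT \<omega>|\<Omega>. exp (s * X \<omega>))"

definition cumulant_gen_fun :: "'a measure \<Rightarrow> ('a \<Rightarrow> real) \<Rightarrow> real \<Rightarrow> real" where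
  "cumulant_gen_fun \<Omega> X s = ln (moment_gen_fun \<Omega> X s)"

(* The denominator vanishes exactly for k = 1, \<theta> = 1; both bounds are then infinite. *)
definition neg_occ_radius :: "nat \<Rightarrow> nat \<Rightarrow> real \<Rightarrow> ereal" where
  "neg_occ_radius m k \<theta> =
     (let d = real m - (real m - real k + 1) * \<theta>
      in if d = 0 then \<infinity> else ereal (real m / d))"

definition neg_occ_log_radius :: "nat \<Rightarrow> nat \<Rightarrow> real \<Rightarrow> ereal" where
  "neg_occ_log_radius m k \<theta> =
     (let d = real m - (real m - real k + 1) * \<theta>
      in if d = 0 then \<infinity> else ereal (ln (real m / d)))"

lemma nc_stirling2_0_right: "nc_stirling2 n 0 \<phi> = \<phi> ^ n"
  by (simp add: nc_stirling2_def)

lemma nc_stirling2_0_left: "nc_stirling2 0 (Suc j) \<phi> = 0"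
proof -
  have "(\<Sum>i\<le>Suc j. real (Suc j choose i) * (-1) ^ (Suc j - i)) = (1 + (-1)) ^ Suc j"
    by (subst binomial_ring) simp
  then show ?thesis by (simp add: nc_stirling2_def)
qed

lemma nc_stirling2_Suc_Suc:
  "nc_stirling2 (Suc n) (Suc j) \<phi> =
     (real (Suc j) + \<phi>) * nc_stirling2 n (Suc j) \<phi> + nc_stirling2 n j \<phi>"
proof -
  let ?a = "\<lambda>i. real (Suc j choose i) * (-1) ^ (Suc j - i) * (real i + \<phi>) ^ n"
  let ?b = "\<lambda>i. real (j choose i) * (-1) ^ (j - i) * (real i + \<phi>) ^ n"
  have diff: "(real (Suc j) + \<phi> - (real i + \<phi>)) * ?a i = - real (Suc j) * ?b i" if "i \<le> j" for i
  proof -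
    have "real (Suc j - i) * real (Suc j choose i) = real (Suc j) * real (j choose i)"
      using binomial_absorb_comp[of "Suc j" i] by (metis diff_Suc_1 of_nat_mult)
    then have absorb: "(real (Suc j) - real i) * real (Suc j choose i) = real (Suc j) * real (j choose i)"
      using that by (simp add: of_nat_diff)
    have sgn: "(-1 :: real) ^ (Suc j - i) = - ((-1) ^ (j - i))"
      using that by (simp add: Suc_diff_le)
    have "(real (Suc j) + \<phi> - (real i + \<phi>)) * ?a i =
        ((real (Suc j) - real i) * real (Suc j choose i)) * ((-1) ^ (Suc j - i) * (real i + \<phi>) ^ n)"
      by (simp only: add_diff_cancel_right mult.assoc)
    also have "\<dots> = - real (Suc j) * ?b i"
      unfolding absorb sgn by (simp only: mult.assoc mult_minus_left mult_minus_right)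
    finally show ?thesis .
  qed
  have "(real (Suc j) + \<phi>) * (\<Sum>i\<le>Suc j. ?a i) - (\<Sum>i\<le>Suc j. (real i + \<phi>) * ?a i) =
        (\<Sum>i\<le>Suc j. (real (Suc j) + \<phi> - (real i + \<phi>)) * ?a i)"
    by (simp only: sum_distrib_left sum_subtractf[symmetric] left_diff_distrib)
  also have "\<dots> = (\<Sum>i\<le>j. (real (Suc j) + \<phi> - (real i + \<phi>)) * ?a i)"
    by simp
  also have "\<dots> = (\<Sum>i\<le>j. - real (Suc j) * ?b i)"
    using diff by (intro sum.cong) simp_all
  also have "\<dots> = - real (Suc j) * (\<Sum>i\<le>j. ?b i)"
    by (simp only: sum_distrib_left)
  finally have eq: "(\<Sum>i\<le>Suc j. (real i + \<phi>) * ?a i) =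
      (real (Suc j) + \<phi>) * (\<Sum>i\<le>Suc j. ?a i) + real (Suc j) * (\<Sum>i\<le>j. ?b i)"
    by (simp only: minus_mult_left[symmetric])
  have "nc_stirling2 (Suc n) (Suc j) \<phi> = 1 / fact (Suc j) * (\<Sum>i\<le>Suc j. (real i + \<phi>) * ?a i)"
    unfolding nc_stirling2_def by (simp only: power_Suc mult.left_commute)
  also have "\<dots> = (real (Suc j) + \<phi>) * (1 / fact (Suc j) * (\<Sum>i\<le>Suc j. ?a i)) +
      real (Suc j) / fact (Suc j) * (\<Sum>i\<le>j. ?b i)"
    unfolding eq by (simp only: divide_inverse mult_1_left distrib_left mult_ac)
  also have "real (Suc j) / fact (Suc j) = 1 / fact j"
    by (simp add: divide_simps)
  finally show ?thesis unfolding nc_stirling2_def .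
qed

lemma nc_stirling2_eq_0: "n < j \<Longrightarrow> nc_stirling2 n j \<phi> = 0"
proof (induction n arbitrary: j)
  case 0
  then show ?case by (cases j) (simp_all add: nc_stirling2_0_left)
next
  case (Suc n)
  then show ?case by (cases j) (simp_all add: nc_stirling2_Suc_Suc)
qed

lemma nc_stirling2_same: "nc_stirling2 j j \<phi> = 1"
  by (induction j) (simp_all add: nc_stirling2_0_right nc_stirling2_Suc_Suc nc_stirling2_eq_0)

lemma neg_occ_mass_1:
  assumes "0 < m" "0 < \<theta>"
  shows "neg_occ_mass m (Suc 0) \<theta> t = \<theta> * (1 - \<theta>) ^ t"
proof -
  have "(\<theta> / real m) ^ t * (real m * ((1 - \<theta>) / \<theta>)) ^ t = (1 - \<theta>) ^ t"
    using assms by (simp add: power_mult_distrib[symmetric])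
  moreover have "neg_occ_mass m (Suc 0) \<theta> t =
      \<theta> * ((\<theta> / real m) ^ t * (real m * ((1 - \<theta>) / \<theta>)) ^ t)"
    using assms
    by (simp add: neg_occ_mass_def falling_factorial_def nc_stirling2_0_right power_divide)
  ultimately show ?thesis by simp
qed

lemma neg_occ_mass_Suc_0:
  assumes "0 < k"
  shows "neg_occ_mass m (Suc k) \<theta> 0 = \<theta> / m * (real m - real k) * neg_occ_mass m k \<theta> 0"
proof -
  have "nc_stirling2 k k \<phi> = 1" "nc_stirling2 (k - 1) (k - 1) \<phi> = 1" for \<phi>
    by (simp_all add: nc_stirling2_same)
  then show ?thesis
    by (simp add: neg_occ_mass_def falling_factorial_def)
qed

lemma neg_occ_mass_Suc_Suc:
  assumes "0 < k" "0 < m" "0 < \<theta>"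
  shows "neg_occ_mass m (Suc k) \<theta> (Suc t) =
    (1 - \<theta> / m * (real m - real k)) * neg_occ_mass m (Suc k) \<theta> t +
    \<theta> / m * (real m - real k) * neg_occ_mass m k \<theta> (Suc t)"
proof -
  define \<phi> where "\<phi> = real m * ((1 - \<theta>) / \<theta>)"
  obtain j where j: "k = Suc j" using assms by (cases k) auto
  have c: "1 - \<theta> / m * (real m - real k) = \<theta> / m * (real k + \<phi>)"
    using assms by (simp add: \<phi>_def field_simps)
  have rec: "nc_stirling2 (Suc (k + t)) k \<phi> =
      (real k + \<phi>) * nc_stirling2 (k + t) k \<phi> + nc_stirling2 (k + t) (k - 1) \<phi>"
    by (simp add: j nc_stirling2_Suc_Suc)
  have ff: "falling_factorial (real m) (Suc k) = falling_factorial (real m) k * (real m - real k)"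
    by (simp add: falling_factorial_def)
  define r where "r = \<theta> / real m"
  have "neg_occ_mass m (Suc k) \<theta> (Suc t) = r * r ^ Suc (k + t) * (falling_factorial (real m) k * (real m - real k)) *
      ((real k + \<phi>) * nc_stirling2 (k + t) k \<phi> + nc_stirling2 (k + t) (k - 1) \<phi>)"
    unfolding neg_occ_mass_def \<phi>_def[symmetric] ff by (simp add: r_def power_divide rec)
  moreover have "neg_occ_mass m (Suc k) \<theta> t = r ^ Suc (k + t) *
      (falling_factorial (real m) k * (real m - real k)) * nc_stirling2 (k + t) k \<phi>"
    unfolding neg_occ_mass_def \<phi>_def[symmetric] ff by (simp add: r_def power_divide)
  moreover have "neg_occ_mass m k \<theta> (Suc t) = r ^ Suc (k + t) *
      falling_factorial (real m) k * nc_stirling2 (k + t) (k - 1) \<phi>"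
    unfolding neg_occ_mass_def \<phi>_def[symmetric] by (simp add: r_def power_divide)
  ultimately show ?thesis
    unfolding c[folded r_def] r_def[symmetric] by (simp only: distrib_left distrib_right mult_ac)
qed

lemma neg_occ_mass_nonneg_sums:
  assumes "0 < k" "k \<le> m" "0 < \<theta>" "\<theta> \<le> 1"
  shows "(\<forall>t. 0 \<le> neg_occ_mass m k \<theta> t) \<and> neg_occ_mass m k \<theta> sums 1"
  using assms(1,2)
proof (induction k rule: nat_induct_non_zero)
  case 1
  have "(\<lambda>t. \<theta> * (1 - \<theta>) ^ t) sums (\<theta> * (1 / (1 - (1 - \<theta>))))"
    using assms by (intro sums_mult geometric_sums) auto
  then have "(\<lambda>t. neg_occ_mass m 1 \<theta> t) sums 1"
    using assms 1 by (simp add: neg_occ_mass_1)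
  then show ?case using assms 1 by (simp add: neg_occ_mass_1)
next
  case (Suc k)
  define q where "q = \<theta> / m * (real m - real k)"
  define p where "p = neg_occ_mass m k \<theta>"
  define p' where "p' = neg_occ_mass m (Suc k) \<theta>"
  have p: "\<And>t. 0 \<le> p t" "p sums 1" using Suc by (auto simp: p_def)
  have "0 < q" using Suc assms by (simp add: q_def)
  have "real m - real k \<le> real m" by simp
  then have "q \<le> \<theta> / m * real m"
    unfolding q_def using assms by (intro mult_left_mono) auto
  then have "q \<le> 1" using assms Suc by simp
  have rec: "p' (Suc t) = (1 - q) * p' t + q * p (Suc t)" for t
    using neg_occ_mass_Suc_Suc[of k m \<theta> t] Suc assms by (simp add: p_def p'_def q_def)
  have conv: "p' t = (\<Sum>i\<le>t. q * p i * (1 - q) ^ (t - i))" for t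
  proof (induction t)
    case 0
    then show ?case
      using neg_occ_mass_Suc_0[of k m \<theta>] Suc.hyps by (simp add: p_def p'_def q_def)
  next
    case (Suc t)
    have "(1 - q) * (\<Sum>i\<le>t. q * p i * (1 - q) ^ (t - i)) =
        (\<Sum>i\<le>t. q * p i * (1 - q) ^ (Suc t - i))"
      unfolding sum_distrib_left by (intro sum.cong) (auto simp: Suc_diff_le)
    then show ?case by (simp add: rec Suc)
  qed
  have "(\<lambda>t. \<Sum>i\<le>t. q * p i * (1 - q) ^ (t - i)) sums ((\<Sum>t. q * p t) * (\<Sum>t. (1 - q) ^ t))"
    using p \<open>0 < q\<close> \<open>q \<le> 1\<close>
    by (intro Cauchy_product_sums) (auto simp: abs_mult sums_iff intro!: summable_mult summable_geometric)
  moreover have "(\<Sum>t. q * p t) = q"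
    using sums_mult[OF p(2), of q] by (simp add: sums_iff)
  moreover have "(\<Sum>t. (1 - q) ^ t) = 1 / q"
    using \<open>0 < q\<close> \<open>q \<le> 1\<close> by (subst suminf_geometric) auto
  ultimately have "p' sums 1" using \<open>0 < q\<close> by (simp add: conv[abs_def])
  moreover have "0 \<le> p' t" for t
    unfolding conv using p \<open>0 < q\<close> \<open>q \<le> 1\<close> by (intro sum_nonneg) auto
  ultimately show ?case by (simp add: p'_def)
qed

lemma pmf_neg_occ:
  assumes "0 < k" "k \<le> m" "0 < \<theta>" "\<theta> \<le> 1"
  shows "pmf (neg_occ m k \<theta>) t = neg_occ_mass m k \<theta> t"
  unfolding neg_occ_def
proof (rule pmf_embed_pmf)
  note * = neg_occ_mass_nonneg_sums[OF assms]
  show "0 \<le> neg_occ_mass m k \<theta> x" for x using * by blast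
  show "(\<integral>\<^sup>+x. ennreal (neg_occ_mass m k \<theta> x) \<partial>count_space UNIV) = 1"
    unfolding nn_integral_count_space_nat
    by (subst suminf_ennreal_eq[where x = 1]) (use * in blast, use * in blast, rule ennreal_1)
qed

end

theory Submission
  imports Defs
begin

text \<open>
  Writing \<open>q = \<theta> (m - k) / m\<close>, the recurrence for the mass function says that the masses for
  \<open>k + 1\<close> are the convolution of the masses for \<open>k\<close> with the geometric masses \<open>q (1 - q) ^ t\<close>.
  Hence passing from \<open>k\<close> to \<open>k + 1\<close> multiplies the generating function by
  \<open>q / (1 - (1 - q) z)\<close>, which is the new factor \<open>l = m - k\<close>; its pole \<open>1 / (1 - q)\<close>
  lies closer to the origin than all earlier ones and so determines the radius.
\<close>

section \<open>Power series with the masses as coefficients\<close>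

text \<open>Unrolling the recurrence shows \<open>b\<close> to be the Cauchy product of
  \<open>q * a\<close> with the powers of \<open>r\<close>. Absolute summability is among the
  conclusions so that the result can be fed back into the lemma in an induction.\<close>

lemma geometric_recurrence_sums:
  fixes a b :: "nat \<Rightarrow> 'a :: {real_normed_field, banach}"
  assumes b0: "b 0 = q * a 0" and bSuc: "\<And>n. b (Suc n) = r * b n + q * a (Suc n)"
    and r: "norm r < 1" and abs: "summable (\<lambda>n. norm (a n))" and A: "a sums A"
  shows "summable (\<lambda>n. norm (b n))" and "b sums (q * A / (1 - r))"
proof -
  have conv: "b n = (\<Sum>i\<le>n. (q * a i) * r ^ (n - i))" for n
  proof (induction n)
    case 0
    then show ?case by (simp add: b0)
  next
    case (Suc n)
    have "r * (\<Sum>i\<le>n. (q * a i) * r ^ (n - i)) = (\<Sum>i\<le>n. (q * a i) * r ^ (Suc n - i))"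
      unfolding sum_distrib_left by (intro sum.cong) (auto simp: Suc_diff_le)
    then show ?case by (simp add: bSuc Suc)
  qed
  have abs_qa: "summable (\<lambda>n. norm (q * a n))"
    by (simp add: norm_mult summable_mult abs)
  have abs_r: "summable (\<lambda>n. norm (r ^ n))"
    using r by (simp add: norm_power summable_geometric)
  \<comment> \<open>The Cauchy product of the two norm series majorises \<open>norm (b n)\<close> by
    the triangle inequality.\<close>
  have "summable (\<lambda>n. \<Sum>i\<le>n. norm (q * a i) * norm (r ^ (n - i)))"
    by (rule summable_Cauchy_product) (use abs_qa abs_r in simp_all)
  then show "summable (\<lambda>n. norm (b n))"
  proof (rule summable_comparison_test'[where N = 0])
    fix n
    show "norm (norm (b n)) \<le> (\<Sum>i\<le>n. norm (q * a i) * norm (r ^ (n - i)))"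
      unfolding conv real_norm_def abs_norm_cancel by (rule sum_norm_le) (simp add: norm_mult)
  qed
  have "(\<lambda>n. \<Sum>i\<le>n. (q * a i) * r ^ (n - i)) sums ((\<Sum>n. q * a n) * (\<Sum>n. r ^ n))"
    by (rule Cauchy_product_sums[OF abs_qa abs_r])
  moreover have "(\<Sum>n. q * a n) = q * A"
    using sums_mult[OF A, of q] by (simp add: sums_iff)
  ultimately show "b sums (q * A / (1 - r))"
    using r by (simp add: conv[abs_def] suminf_geometric)
qed

text \<open>The coefficient \<open>real m - real l * \<theta>\<close> decreases in \<open>l\<close>,
  so the bound at the smallest index of the product controls every factor. The assumption
  \<open>m < l + k\<close> says \<open>m - k + 1 \<le> l\<close> without truncated
  subtraction.\<close>

lemma neg_occ_denominator_pos:
  fixes x :: real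
  assumes "l \<le> m" "m < l + k" "0 < m" "0 < \<theta>" "\<theta> \<le> 1" "0 \<le> x"
    and "x * (real m - (real m - real k + 1) * \<theta>) < real m"
  shows "0 \<le> real m - real l * \<theta>" and "(real m - real l * \<theta>) * x < real m"
proof -
  have "real l * \<theta> \<le> real m * 1"
    using assms by (intro mult_mono) auto
  then show "0 \<le> real m - real l * \<theta>" by simp
  have "(real m - real k + 1) * \<theta> \<le> real l * \<theta>"
    using assms by (intro mult_right_mono) auto
  then have "x * (real m - real l * \<theta>) \<le> x * (real m - (real m - real k + 1) * \<theta>)"
    using assms by (intro mult_left_mono) auto
  then show "(real m - real l * \<theta>) * x < real m"
    using assms by (simp add: mult.commute)
qed

text \<open>Induction on \<open>k\<close> with \<open>geometric_recurrence_sums\<close> as the step.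
  The bound on \<open>norm z\<close> is stated multiplied out, which also covers
  \<open>k = 1\<close>, \<open>\<theta> = 1\<close>, where the radius is infinite.\<close>

lemma neg_occ_mass_power_sums:
  fixes z :: complex
  assumes "0 < k" "k \<le> m" "0 < \<theta>" "\<theta> \<le> 1"
    and "norm z * (real m - (real m - real k + 1) * \<theta>) < real m"
  shows "summable (\<lambda>t. norm (of_real (neg_occ_mass m k \<theta> t) * z ^ t)) \<and>
    (\<lambda>t. of_real (neg_occ_mass m k \<theta> t) * z ^ t) sums
      (of_real \<theta> ^ k *
        (\<Prod>l = m - k + 1..m. of_nat l / (of_nat m - (of_nat m - of_nat l * of_real \<theta>) * z)))"
  using assms(1,2,5)
proof (induction k rule: nat_induct_non_zero)
  case 1
  \<comment> \<open>For \<open>k = 1\<close> the distribution is geometric, so the series is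
    geometric with ratio \<open>r\<close>.\<close>
  define r where "r = of_real (1 - \<theta>) * z"
  have m: "0 < m" using 1 by simp
  have "real m * (norm z * (1 - \<theta>)) < real m * 1"
    using 1 by (simp add: algebra_simps)
  then have r: "norm r < 1"
    using m assms by (simp add: r_def norm_mult mult.commute del: of_real_diff)
  have mass: "of_real (neg_occ_mass m 1 \<theta> t) * z ^ t = of_real \<theta> * r ^ t" for t
    using m assms by (simp add: neg_occ_mass_1 r_def power_mult_distrib)
  have "of_nat m - (of_nat m - of_nat m * of_real \<theta>) * z = of_nat m * (1 - r)"
    by (simp add: r_def algebra_simps)
  moreover have "m - 1 + 1 = m" using m by simp
  ultimately have val: "of_real \<theta> ^ 1 *
      (\<Prod>l = m - 1 + 1..m. of_nat l / (of_nat m - (of_nat m - of_nat l * of_real \<theta>) * z)) =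
      of_real \<theta> * (1 / (1 - r))"
    using m by simp
  show ?case
    unfolding mass val using r sums_mult[OF geometric_sums[OF r], of "of_real \<theta>"]
    by (simp add: norm_mult norm_power summable_mult summable_geometric)
next
  case (Suc k)
  \<comment> \<open>The one index that the product gains when \<open>k\<close> becomes
    \<open>Suc k\<close>, and the smallest one there.\<close>
  define l where "l = m - k"
  define q where "q = \<theta> * real l / real m"
  define a where "a t = of_real (neg_occ_mass m k \<theta> t) * z ^ t" for t
  define b where "b t = of_real (neg_occ_mass m (Suc k) \<theta> t) * z ^ t" for t
  have m: "0 < m" and km: "k \<le> m" and l: "real l = real m - real k" "m - Suc k + 1 = l" "l \<le> m"
    using Suc by (auto simp: l_def)
  have q: "q = \<theta> / m * (real m - real k)" by (simp add: q_def l)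
  have d: "(real m - real l * \<theta>) * norm z < real m" "0 \<le> real m - real l * \<theta>"
    using neg_occ_denominator_pos[of l m "Suc k" \<theta> "norm z"] Suc.prems Suc.hyps m l assms
    by (auto simp: l_def)
  \<comment> \<open>The bound tightens as \<open>k\<close> grows, so the one for
    \<open>Suc k\<close> implies the one that the induction hypothesis asks for.\<close>
  have "norm z * (real m - (real m - real k + 1) * \<theta>) \<le>
      norm z * (real m - (real m - real (Suc k) + 1) * \<theta>)"
    using assms by (intro mult_left_mono) (auto simp: algebra_simps)
  then have IH: "summable (\<lambda>t. norm (a t))" "a sums (of_real \<theta> ^ k *
      (\<Prod>l = m - k + 1..m. of_nat l / (of_nat m - (of_nat m - of_nat l * of_real \<theta>) * z)))"
    using Suc.IH Suc.prems km unfolding a_def by auto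
  have q1: "1 - q = (real m - real l * \<theta>) / real m"
    using m by (simp add: q_def field_simps)
  have r: "norm (of_real (1 - q) * z) < 1"
    unfolding q1 norm_mult norm_of_real using d m by (simp add: abs_div_pos)
  have b0: "b 0 = of_real q * a 0"
    using Suc.hyps by (simp add: a_def b_def q neg_occ_mass_Suc_0)
  \<comment> \<open>Multiplying the recurrence of the masses by \<open>z ^ Suc t\<close> attaches
    one factor \<open>z\<close> to the ratio \<open>1 - q\<close> and leaves the weight
    \<open>q\<close> unchanged.\<close>
  have bSuc: "b (Suc t) = (of_real (1 - q) * z) * b t + of_real q * a (Suc t)" for t
  proof -
    have rec: "neg_occ_mass m (Suc k) \<theta> (Suc t) =
        (1 - q) * neg_occ_mass m (Suc k) \<theta> t + q * neg_occ_mass m k \<theta> (Suc t)"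
      using Suc.hyps m assms(3) unfolding q by (rule neg_occ_mass_Suc_Suc)
    show ?thesis unfolding a_def b_def rec
      by (simp add: distrib_left distrib_right mult_ac del: of_real_diff)
  qed
  note step = geometric_recurrence_sums[of b "of_real q" a, OF b0 bSuc r IH]
  \<comment> \<open>Expanding the fraction by \<open>m\<close> turns the geometric factor into
    \<open>\<theta>\<close> times the factor of the product at \<open>l\<close>, because
    \<open>m * q = \<theta> * l\<close>.\<close>
  have "of_nat m * (1 - of_real (1 - q) * z) =
      of_nat m - (of_nat m - of_nat l * of_real \<theta>) * z"
    unfolding q1 using m by (simp add: field_simps)
  then have "of_real q / (1 - of_real (1 - q) * z) =
      of_nat m * of_real q / (of_nat m - (of_nat m - of_nat l * of_real \<theta>) * z)"
    using m by (metis mult_divide_mult_cancel_left of_nat_eq_0_iff neq0_conv)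
  also have "of_nat m * of_real q = of_real \<theta> * (of_nat l :: complex)"
    using m by (simp add: q_def)
  finally have fac: "of_real q / (1 - of_real (1 - q) * z) =
      of_real \<theta> * (of_nat l / (of_nat m - (of_nat m - of_nat l * of_real \<theta>) * z))"
    by simp
  have set: "{m - Suc k + 1..m} = insert l {m - k + 1..m}"
    using l by (auto simp: l_def)
  have notin: "l \<notin> {m - k + 1..m}" by (simp add: l_def)
  have val: "of_real q * (of_real \<theta> ^ k *
        (\<Prod>l = m - k + 1..m. of_nat l / (of_nat m - (of_nat m - of_nat l * of_real \<theta>) * z))) /
        (1 - of_real (1 - q) * z) =
      of_real \<theta> ^ Suc k *
        (\<Prod>l = m - Suc k + 1..m. of_nat l / (of_nat m - (of_nat m - of_nat l * of_real \<theta>) * z))"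
    unfolding set prod.insert[OF finite_atLeastAtMost notin] power_Suc
      times_divide_eq_left[of "of_real q" "1 - of_real (1 - q) * z", symmetric] fac
    by (simp only: mult_ac)
  show ?case
    using step unfolding val b_def by blast
qed

section \<open>Expectations as series, and the radius in multiplied-out form\<close>

text \<open>\<open>measure_pmf p\<close> has density \<open>pmf p\<close> with respect to counting
  measure, and integrals over counting measure on the naturals are absolutely convergent
  series.\<close>

lemma integral_measure_pmf_nat:
  fixes f :: "nat \<Rightarrow> 'a :: {banach, second_countable_topology}"
  assumes "summable (\<lambda>t. norm (pmf p t *\<^sub>R f t))"
  shows "integrable (measure_pmf p) f" and "(LINT t|measure_pmf p. f t) = (\<Sum>t. pmf p t *\<^sub>R f t)"
proof -
  have int: "integrable (count_space UNIV) (\<lambda>t. pmf p t *\<^sub>R f t)"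
    using assms by (simp add: integrable_count_space_nat_iff)
  then show "integrable (measure_pmf p) f"
    unfolding measure_pmf_eq_density by (subst integrable_density) auto
  show "(LINT t|measure_pmf p. f t) = (\<Sum>t. pmf p t *\<^sub>R f t)"
    unfolding measure_pmf_eq_density using int
    by (subst integral_density) (auto simp: integral_count_space_nat)
qed

text \<open>The denominator of the radius is nonnegative since \<open>\<theta> \<le> 1\<close> and
  \<open>0 < k\<close>. If it is positive, it can be cleared; if it is zero, both sides hold, the
  right one because it reads \<open>0 < m\<close>.\<close>

lemma less_neg_occ_radius_iff:
  assumes "0 < k" "k \<le> m" "0 < \<theta>" "\<theta> \<le> 1"
  shows "ereal x < neg_occ_radius m k \<theta> \<longleftrightarrow> x * (real m - (real m - real k + 1) * \<theta>) < real m"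
proof -
  have "(real m - real k + 1) * \<theta> \<le> real m * 1"
    using assms by (intro mult_mono) auto
  then show ?thesis
    using assms by (auto simp: neg_occ_radius_def Let_def pos_less_divide_eq)
qed

lemma less_neg_occ_log_radius_iff:
  assumes "0 < k" "k \<le> m" "0 < \<theta>" "\<theta> \<le> 1"
  shows "ereal s < neg_occ_log_radius m k \<theta> \<longleftrightarrow> ereal (exp s) < neg_occ_radius m k \<theta>"
proof -
  have "(real m - real k + 1) * \<theta> \<le> real m * 1"
    using assms by (intro mult_mono) auto
  moreover have "s < ln (real m / d) \<longleftrightarrow> exp s < real m / d" if "0 < d" for d
    using that assms exp_less_cancel_iff[of s "ln (real m / d)"] by simp
  ultimately show ?thesis
    by (auto simp: neg_occ_log_radius_def neg_occ_radius_def Let_def)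
qed

section \<open>The generating functions of \<open>T\<close>\<close>

text \<open>Both claims are transported from the law of \<open>T\<close>. Integrability is stated
  separately because the Bochner integral of a non-integrable function is 0 by convention.\<close>

lemma neg_occ_prob_gen_fun:
  fixes z :: complex
  assumes "0 < k" "k \<le> m" "0 < \<theta>" "\<theta> \<le> 1"
    and T: "T \<in> measurable \<Omega> (count_space UNIV)"
    and distr: "distr \<Omega> (count_space UNIV) T = measure_pmf (neg_occ m k \<theta>)"
    and z: "ereal (norm z) < neg_occ_radius m k \<theta>"
  shows "integrable \<Omega> (\<lambda>\<omega>. z ^ T \<omega>)"
    and "prob_gen_fun \<Omega> T z = of_real \<theta> ^ k *
      (\<Prod>l = m - k + 1..m. of_nat l / (of_nat m - (of_nat m - of_nat l * of_real \<theta>) * z))"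
proof -
  note sums = neg_occ_mass_power_sums[OF assms(1-4) z[unfolded less_neg_occ_radius_iff[OF assms(1-4)]]]
  have pmf: "pmf (neg_occ m k \<theta>) t *\<^sub>R z ^ t = of_real (neg_occ_mass m k \<theta> t) * z ^ t" for t
    by (simp add: pmf_neg_occ[OF assms(1-4)] scaleR_conv_of_real)
  have "summable (\<lambda>t. norm (pmf (neg_occ m k \<theta>) t *\<^sub>R z ^ t))"
    using sums unfolding pmf by blast
  note int = integral_measure_pmf_nat[OF this]
  show "integrable \<Omega> (\<lambda>\<omega>. z ^ T \<omega>)"
    using int(1) T by (simp add: distr[symmetric] integrable_distr_eq)
  have "prob_gen_fun \<Omega> T z = (LINT t|distr \<Omega> (count_space UNIV) T. z ^ t)"
    using T by (simp add: prob_gen_fun_def integral_distr)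
  also have "\<dots> = (\<Sum>t. of_real (neg_occ_mass m k \<theta> t) * z ^ t)"
    unfolding distr int(2) pmf ..
  finally show "prob_gen_fun \<Omega> T z = of_real \<theta> ^ k *
      (\<Prod>l = m - k + 1..m. of_nat l / (of_nat m - (of_nat m - of_nat l * of_real \<theta>) * z))"
    using sums by (simp add: sums_iff)
qed

text \<open>This is the probability generating function at the real point \<open>exp s\<close>; the
  identity is proved in the complex numbers and pulled back by injectivity of the embedding.\<close>

lemma neg_occ_moment_gen_fun:
  fixes s :: real
  assumes k: "0 < k" "k \<le> m" "0 < \<theta>" "\<theta> \<le> 1"
    and T: "T \<in> measurable \<Omega> (count_space UNIV)"
    and distr: "distr \<Omega> (count_space UNIV) T = measure_pmf (neg_occ m k \<theta>)"
    and s: "ereal s < neg_occ_log_radius m k \<theta>"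
  shows "integrable \<Omega> (\<lambda>\<omega>. exp (s * real (T \<omega>)))"
    and "moment_gen_fun \<Omega> (\<lambda>\<omega>. real (T \<omega>)) s =
      \<theta> ^ k * (\<Prod>l = m - k + 1..m. real l / (real m - (real m - real l * \<theta>) * exp s))"
proof -
  let ?z = "complex_of_real (exp s)"
  have "ereal (norm ?z) < neg_occ_radius m k \<theta>"
    using s unfolding less_neg_occ_log_radius_iff[OF k] norm_of_real by simp
  note gen = neg_occ_prob_gen_fun[OF k T distr this]
  have pow: "?z ^ n = complex_of_real (exp (s * real n))" for n
    by (simp only: exp_of_nat2_mult of_real_power)
  show int: "integrable \<Omega> (\<lambda>\<omega>. exp (s * real (T \<omega>)))"
    using gen(1) unfolding pow by (simp only: complex_of_real_integrable_eq)
  have "complex_of_real (moment_gen_fun \<Omega> (\<lambda>\<omega>. real (T \<omega>)) s) = prob_gen_fun \<Omega> T ?z"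
    unfolding moment_gen_fun_def prob_gen_fun_def pow by (rule integral_complex_of_real[symmetric])
  also have "\<dots> = complex_of_real
      (\<theta> ^ k * (\<Prod>l = m - k + 1..m. real l / (real m - (real m - real l * \<theta>) * exp s)))"
    unfolding gen(2) by simp
  finally show "moment_gen_fun \<Omega> (\<lambda>\<omega>. real (T \<omega>)) s =
      \<theta> ^ k * (\<Prod>l = m - k + 1..m. real l / (real m - (real m - real l * \<theta>) * exp s))"
    by (simp only: of_real_eq_iff)
qed

theorem theorem3:
  fixes k m :: nat and \<theta> :: real
    and \<Omega> :: "'a measure" and T :: "'a \<Rightarrow> nat"
  assumes "0 < k" and "k \<le> m" and "0 < \<theta>" and "\<theta> \<le> 1"
    and "prob_space \<Omega>"
    and "T \<in> measurable \<Omega> (count_space UNIV)"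
    and "distr \<Omega> (count_space UNIV) T = measure_pmf (neg_occ m k \<theta>)"
  shows
    "(\<forall>z::complex. ereal (norm z) < neg_occ_radius m k \<theta> \<longrightarrow>
        integrable \<Omega> (\<lambda>\<omega>. z ^ T \<omega>) \<and>
        prob_gen_fun \<Omega> T z =
          complex_of_real \<theta> ^ k *
          (\<Prod>l = m - k + 1..m. of_nat l / (of_nat m - (of_nat m - of_nat l * complex_of_real \<theta>) * z))) \<and>
     (\<forall>s::real. ereal \<bar>s\<bar> < neg_occ_log_radius m k \<theta> \<longrightarrow>
        char (distr \<Omega> borel (\<lambda>\<omega>. real (T \<omega>))) s =
          complex_of_real \<theta> ^ k *
          (\<Prod>l = m - k + 1..m. of_nat l /
             (of_nat m - (of_nat m - of_nat l * complex_of_real \<theta>) * exp (\<i> * complex_of_real s)))) \<and>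
     (\<forall>s::real. ereal s < neg_occ_log_radius m k \<theta> \<longrightarrow>
        integrable \<Omega> (\<lambda>\<omega>. exp (s * real (T \<omega>))) \<and>
        moment_gen_fun \<Omega> (\<lambda>\<omega>. real (T \<omega>)) s =
          \<theta> ^ k * (\<Prod>l = m - k + 1..m. real l / (real m - (real m - real l * \<theta>) * exp s))) \<and>
     (\<forall>s::real. ereal s < neg_occ_log_radius m k \<theta> \<longrightarrow>
        cumulant_gen_fun \<Omega> (\<lambda>\<omega>. real (T \<omega>)) s =
          real k * ln \<theta> +
          (\<Sum>l = m - k + 1..m. ln (real l / (real m - (real m - real l * \<theta>) * exp s))))"
proof (intro conjI allI impI)
  note k = assms(1-4) and T = assms(6) and distr = assms(7)
  show "integrable \<Omega> (\<lambda>\<omega>. z ^ T \<omega>)"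
    and "prob_gen_fun \<Omega> T z = complex_of_real \<theta> ^ k *
      (\<Prod>l = m - k + 1..m. of_nat l / (of_nat m - (of_nat m - of_nat l * complex_of_real \<theta>) * z))"
    if "ereal (norm z) < neg_occ_radius m k \<theta>" for z
    using neg_occ_prob_gen_fun[OF k T distr that] by auto
  show "integrable \<Omega> (\<lambda>\<omega>. exp (s * real (T \<omega>)))"
    and mgf: "moment_gen_fun \<Omega> (\<lambda>\<omega>. real (T \<omega>)) s =
      \<theta> ^ k * (\<Prod>l = m - k + 1..m. real l / (real m - (real m - real l * \<theta>) * exp s))"
    if "ereal s < neg_occ_log_radius m k \<theta>" for s
    using neg_occ_moment_gen_fun[OF k T distr that] by auto
  show "char (distr \<Omega> borel (\<lambda>\<omega>. real (T \<omega>))) s = complex_of_real \<theta> ^ k *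
      (\<Prod>l = m - k + 1..m. of_nat l /
        (of_nat m - (of_nat m - of_nat l * complex_of_real \<theta>) * exp (\<i> * complex_of_real s)))"
    if "ereal \<bar>s\<bar> < neg_occ_log_radius m k \<theta>" for s
  proof -
    \<comment> \<open>The point \<open>exp (\<i> * s)\<close> has norm 1, which is at most
      \<open>exp \<bar>s\<bar>\<close>, so the condition on \<open>\<bar>s\<bar>\<close> places it
      inside the disc of convergence.\<close>
    have "ereal (norm (exp (\<i> * complex_of_real s))) \<le> ereal (exp \<bar>s\<bar>)"
      by simp
    also have "\<dots> < neg_occ_radius m k \<theta>"
      using that by (simp add: less_neg_occ_log_radius_iff[OF k])
    finally have "prob_gen_fun \<Omega> T (exp (\<i> * complex_of_real s)) = complex_of_real \<theta> ^ k *
      (\<Prod>l = m - k + 1..m. of_nat l /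
        (of_nat m - (of_nat m - of_nat l * complex_of_real \<theta>) * exp (\<i> * complex_of_real s)))"
      by (rule neg_occ_prob_gen_fun(2)[OF k T distr])
    moreover have "iexp (s * real n) = exp (\<i> * complex_of_real s) ^ n" for n
      by (simp add: exp_of_nat_mult[symmetric] mult_ac)
    moreover have "(\<lambda>\<omega>. real (T \<omega>)) \<in> borel_measurable \<Omega>"
      using T by measurable
    ultimately show ?thesis
      by (simp add: char_def integral_distr prob_gen_fun_def)
  qed
  show "cumulant_gen_fun \<Omega> (\<lambda>\<omega>. real (T \<omega>)) s = real k * ln \<theta> +
      (\<Sum>l = m - k + 1..m. ln (real l / (real m - (real m - real l * \<theta>) * exp s)))"
    if s: "ereal s < neg_occ_log_radius m k \<theta>" for s
  proof -
    have "exp s * (real m - (real m - real k + 1) * \<theta>) < real m"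
      using s by (simp add: less_neg_occ_log_radius_iff[OF k] less_neg_occ_radius_iff[OF k])
    \<comment> \<open>Numerators are positive because \<open>l\<close> is at least
      \<open>m - k + 1\<close>, denominators by the radius condition at \<open>exp s\<close>.
      Positivity of all factors lets the logarithm of the product split into a sum.\<close>
    then have pos: "0 < real l / (real m - (real m - real l * \<theta>) * exp s)"
      if "l \<in> {m - k + 1..m}" for l
      using neg_occ_denominator_pos(2)[of l m k \<theta> "exp s"] that k by auto
    let ?P = "\<Prod>l = m - k + 1..m. real l / (real m - (real m - real l * \<theta>) * exp s)"
    have "ln ?P = (\<Sum>l = m - k + 1..m. ln (real l / (real m - (real m - real l * \<theta>) * exp s)))"
      by (intro ln_prod) (simp_all add: less_imp_neq[OF pos, symmetric] del: divide_eq_0_iff)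
    moreover have "0 < ?P"
      using pos by (rule prod_pos)
    then have "ln (\<theta> ^ k * ?P) = real k * ln \<theta> + ln ?P"
      using k by (simp only: ln_mult_pos zero_less_power ln_realpow)
    ultimately show ?thesis
      by (simp only: cumulant_gen_fun_def mgf[OF s])
  qed
qed

end
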